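(* If $K$ is an infinite field of characteristic not equal to $2$ or $3$ in which $2$ is not the cube of an element of $K$, then $K\in\mathcal{N}_{3,2}^\infty$. In particular, if $K$ is a number field with ring of integers $\mathcal{O}_K$ and $2$ is not the cube of an element of $K$, then there are infinitely many monic $f\in\mathcal{O}_K[x]$ of degree $3$ with newly reducible second iterate over $K$.
   Context: $f^2$ denotes the second iterate $f\circ f$. $f$ has a newly reducible second iterate over $K$ if $f$ is irreducible over $K$ but $f^2$ is not irreducible over $K$. $K\in\mathcal{N}_{3,2}^\infty$ means that there are infinitely many $f\in K[x]$ of degree $3$ with newly reducible second iterate over $K$. *)

theory Defs
  imports Complex_Main "HOL-Computational_Algebra.Computational_Algebra"
begin

definition newly_reducible_second_iterate :: "'a::field poly \<Rightarrow> bool" where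
  "newly_reducible_second_iterate f \<longleftrightarrow> irreducible f \<and> \<not> irreducible (pcompose f f)"

text \<open>The class \<open>\<N>\<^sub>3\<^sub>,\<^sub>2\<^sup>\<infinity>\<close>, where the field \<open>K\<close> is the type \<open>'a\<close>.\<close>

definition N32_inf :: "'a::field itself \<Rightarrow> bool" where
  "N32_inf K \<longleftrightarrow> infinite {f :: 'a poly. degree f = 3 \<and> newly_reducible_second_iterate f}"

text \<open>The field \<open>'a\<close>, of characteristic 0, is a finite extension of the rationals.\<close>

definition number_field :: "'a::field_char_0 itself \<Rightarrow> bool" where
  "number_field K \<longleftrightarrow>
     (\<exists>B. finite_dimensional_vector_space (\<lambda>(q::rat) (x::'a). of_rat q * x) B)"

definition ring_of_integers :: "'a::field_char_0 set" where
  "ring_of_integers = {x. algebraic_int x}"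

end

theory Submission
  imports Defs
begin

text \<open>
  Let \<open>\<theta>\<close> be a cube root of \<open>2\<close> and look for \<open>f\<close> with roots \<open>m\<theta> - c\<close>, that is
  \<open>f(x) = (x + c)\<^sup>3 - 2m\<^sup>3\<close>. When \<open>m \<noteq> 0\<close>, a root of \<open>f\<close> in the ground field \<open>K\<close> would yield a
  cube root of \<open>2\<close> in \<open>K\<close>, so \<open>f\<close> is an irreducible cubic. The iterate \<open>f \<circ> f\<close>, of degree \<open>9\<close>,
  splits as soon as some \<open>\<beta>\<close> in \<open>K(\<theta>)\<close> satisfies \<open>f(\<beta>) = m\<theta> - c\<close>, for then the norm to \<open>K\<close> of
  \<open>x - \<beta>\<close> is a cubic factor. Taking \<open>c = m + 2m\<^sup>3\<close> turns this equation into
  \<open>(\<beta> + c)\<^sup>3 = m(\<theta> - 1)\<close>, and it is solvable for \<open>m = 9n\<^sup>3\<close> because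
    \<open>(1 - \<theta> + \<theta>\<^sup>2)\<^sup>3 = 9(\<theta> - 1)\<close>.
  Expanding the norm gives a factorization with coefficients in \<open>\<int>[n]\<close>, hence one valid over
  every field and one in which \<open>\<theta>\<close> no longer occurs (lemma \<open>cubic_form_factorization\<close>).

  The parameter \<open>n\<close> ranges over the nonzero elements of \<open>K\<close>. The quadratic coefficient
  \<open>3c\<close> is a nonconstant polynomial in \<open>n\<close> unless the characteristic is \<open>3\<close>; apart from that
  case, each cubic arises from finitely many \<open>n\<close> only, so an infinite \<open>K\<close>
  provides infinitely many of them. Over a field of characteristic \<open>0\<close> the positive integers
  \<open>n\<close> suffice, and these cubics are monic with rational integer coefficients.
\<close>

lemma irreducible_cubic_if_no_root:
  fixes p :: "'a::field poly"
  assumes deg: "degree p = 3" and no_root: "\<And>x. poly p x \<noteq> 0"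
  shows "irreducible p"
proof (rule irreducibleI)
  show "p \<noteq> 0" using deg by auto
  then show "\<not> is_unit p" using deg by (simp add: is_unit_iff_degree)
next
  have linear_not_dvd: "\<not> q dvd p" if q: "degree q = 1" for q
  proof
    assume "q dvd p"
    obtain a b where "q = [:b, a:]" "a \<noteq> 0" using degree1_coeffs[OF q] by blast
    then have "poly q (- b / a) = 0" by simp
    with \<open>q dvd p\<close> have "poly p (- b / a) = 0" by (auto simp: dvd_def)
    with no_root show False by blast
  qed
  fix a b assume p: "p = a * b"
  with deg have nz: "a \<noteq> 0" "b \<noteq> 0" by auto
  then have "degree a + degree b = 3" using p deg by (simp add: degree_mult_eq)
  moreover have "degree a \<noteq> 1" "degree b \<noteq> 1"
    using linear_not_dvd[of a] linear_not_dvd[of b] by (auto simp: p)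
  ultimately have "degree a = 0 \<or> degree b = 0" by arith
  then show "is_unit a \<or> is_unit b" using nz by (simp add: is_unit_iff_degree)
qed

text \<open>
  This is the cubic \<open>(x + c)\<^sup>3 - 2m\<^sup>3\<close> whose shift \<open>c = m + 2m\<^sup>3\<close> is chosen so that
  \<open>f(x) + c = (x + c)\<^sup>3 + m\<close>: the term \<open>2m\<^sup>3\<close> cancels when \<open>f\<close> is iterated.
\<close>

definition shifted_cubic :: "'a::field \<Rightarrow> 'a poly" where
  "shifted_cubic m = [:m + 2 * m ^ 3, 1:] ^ 3 - [:2 * m ^ 3:]"

lemma shifted_cubic_coeffs:
  "shifted_cubic m =
     [:(m + 2 * m ^ 3) ^ 3 - 2 * m ^ 3, 3 * (m + 2 * m ^ 3) ^ 2, 3 * (m + 2 * m ^ 3), 1:]"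
  by (simp add: shifted_cubic_def power3_eq_cube power2_eq_square algebra_simps)

lemma degree_shifted_cubic: "degree (shifted_cubic m) = 3"
  by (simp add: shifted_cubic_coeffs)

lemma irreducible_shifted_cubic:
  fixes m :: "'a::field"
  assumes "\<not> (\<exists>x::'a. x ^ 3 = 2)" and "m \<noteq> 0"
  shows "irreducible (shifted_cubic m)"
proof (rule irreducible_cubic_if_no_root[OF degree_shifted_cubic])
  fix x
  show "poly (shifted_cubic m) x \<noteq> 0"
  proof
    assume "poly (shifted_cubic m) x = 0"
    then have "((m + 2 * m ^ 3 + x) / m) ^ 3 = 2"
      using \<open>m \<noteq> 0\<close> by (simp add: shifted_cubic_def power_divide)
    with assms(1) show False by blast
  qed
qed

lemma shifted_cubic_second_iterate:
  "pcompose (shifted_cubic m) (shifted_cubic m) =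
     ([:m + 2 * m ^ 3, 1:] ^ 3 + [:m:]) ^ 3 - [:2 * m ^ 3:]"
proof -
  have hom: "pcompose (p ^ 3) q = pcompose p q ^ 3" for p q :: "'a poly"
    by (simp add: power3_eq_cube pcompose_mult)
  have "[:m + 2 * m ^ 3:] + shifted_cubic m = [:m + 2 * m ^ 3, 1:] ^ 3 + [:m:]"
    by (simp add: shifted_cubic_def)
  then show ?thesis
    by (subst (1) shifted_cubic_def) (simp add: pcompose_diff hom pcompose_pCons)
qed

text \<open>
  If \<open>\<theta>\<^sup>3 = 2\<close>, the left-hand side is the product over the three choices of \<open>\<theta>\<close> of
  \<open>X\<^sup>3 - 9N\<^sup>3(\<theta> - 1)\<close>. As \<open>9(\<theta> - 1)\<close> is the cube of \<open>1 - \<theta> + \<theta>\<^sup>2\<close>, each of them is divisible by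
  \<open>X - N(1 - \<theta> + \<theta>\<^sup>2)\<close>, and the product of these linear forms is the cubic factor on the right.
\<close>

lemma cubic_form_factorization:
  fixes X N :: "'a::comm_ring_1"
  shows "(X ^ 3 + 9 * N ^ 3) ^ 3 - 2 * (9 * N ^ 3) ^ 3 =
    (X ^ 3 - 3 * N * X ^ 2 + 9 * N ^ 2 * X - 9 * N ^ 3) *
    (X ^ 6 + 3 * N * X ^ 5 + 9 * N ^ 3 * X ^ 3 + 54 * N ^ 4 * X ^ 2 + 81 * N ^ 5 * X + 81 * N ^ 6)"
  by (simp add: eval_nat_numeral algebra_simps)

lemma reducible_shifted_cubic_second_iterate:
  fixes n :: "'a::field"
  defines "m \<equiv> 9 * n ^ 3"
  shows "\<not> irreducible (pcompose (shifted_cubic m) (shifted_cubic m))"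
proof
  define c where "c = m + 2 * m ^ 3"
  define X where "X = [:c, 1:]"
  define N where "N = [:n:]"
  define G where "G = X ^ 3 - 3 * N * X ^ 2 + 9 * N ^ 2 * X - 9 * N ^ 3"
  define H where "H = X ^ 6 + 3 * N * X ^ 5 + 9 * N ^ 3 * X ^ 3 + 54 * N ^ 4 * X ^ 2
    + 81 * N ^ 5 * X + 81 * N ^ 6"
  have m: "[:m:] = 9 * N ^ 3"
    by (simp add: m_def N_def poly_const_pow numeral_poly)
  have m3: "[:2 * m ^ 3:] = 2 * [:m:] ^ 3"
    by (simp add: poly_const_pow numeral_poly)
  have comp: "pcompose (shifted_cubic m) (shifted_cubic m) = G * H"
    unfolding shifted_cubic_second_iterate m3 m G_def H_def
    by (simp only: cubic_form_factorization[symmetric] X_def c_def)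
  have "G = [:c ^ 3 - 3 * n * c ^ 2 + 9 * n ^ 2 * c - 9 * n ^ 3,
              3 * c ^ 2 - 6 * n * c + 9 * n ^ 2, 3 * c - 3 * n, 1:]"
    by (simp add: G_def X_def N_def numeral_poly power3_eq_cube power2_eq_square algebra_simps)
  then have G: "degree G = 3" by simp
  have "degree (G * H) = 9"
    by (simp add: comp[symmetric] degree_pcompose degree_shifted_cubic)
  then have deg: "degree (G * H) = 9" and "G \<noteq> 0" "H \<noteq> 0" by auto
  then have H: "degree H = 6" using G by (simp add: degree_mult_eq)
  assume "irreducible (pcompose (shifted_cubic m) (shifted_cubic m))"
  from irreducibleD[OF this comp] have "degree G = 0 \<or> degree H = 0"
    using \<open>G \<noteq> 0\<close> \<open>H \<noteq> 0\<close> by (simp add: is_unit_iff_degree)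
  with G H show False by simp
qed

lemma newly_reducible_shifted_cubic:
  fixes n :: "'a::field"
  assumes "\<not> (\<exists>x::'a. x ^ 3 = 2)" and "(3::'a) \<noteq> 0" and "n \<noteq> 0"
  shows "newly_reducible_second_iterate (shifted_cubic (9 * n ^ 3))"
proof -
  have "(9::'a) = 3 * 3" by simp
  then have "9 * n ^ 3 \<noteq> 0" using assms by (metis mult_eq_0_iff power_eq_0_iff)
  then show ?thesis
    using irreducible_shifted_cubic[OF assms(1)] reducible_shifted_cubic_second_iterate[of n]
    by (simp add: newly_reducible_second_iterate_def)
qed

text \<open>
  The quadratic coefficient of the cubic is \<open>3(m + 2m\<^sup>3)\<close> with \<open>m = 9n\<^sup>3\<close>, a polynomial in \<open>n\<close> which is
  nonconstant because \<open>3\<close> is invertible, so that only finitely many \<open>n\<close> share the same cubic.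
\<close>

lemma infinite_shifted_cubics:
  fixes S :: "'a::field set"
  assumes S: "infinite S" and three: "(3::'a) \<noteq> 0"
  shows "infinite ((\<lambda>n. shifted_cubic (9 * n ^ 3)) ` S)"
proof
  let ?F = "\<lambda>n. shifted_cubic (9 * n ^ 3)"
  assume "finite (?F ` S)"
  with S obtain a where "infinite {n \<in> S. ?F n = ?F a}"
    using pigeonhole_infinite[of S ?F] by auto
  moreover
  define q where "q = [:- (9 * a ^ 3 + 2 * (9 * a ^ 3) ^ 3):] + monom 9 3 + monom 1458 9"
  \<comment> \<open>In characteristic \<open>2\<close> the leading term of \<open>q\<close> vanishes, so its cubic term is used instead.\<close>
  have nine: "(9::'a) = 3 * 3" by simp
  have "coeff q 3 = 9" by (simp add: q_def coeff_pCons eval_nat_numeral)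
  then have "q \<noteq> 0" using three nine by (metis coeff_0 mult_eq_0_iff)
  then have "finite {n. poly q n = 0}" by (rule poly_roots_finite)
  moreover have "{n \<in> S. ?F n = ?F a} \<subseteq> {n. poly q n = 0}"
  proof
    fix n assume "n \<in> {n \<in> S. ?F n = ?F a}"
    then have "coeff (?F n) 2 = coeff (?F a) 2" by simp
    then have "3 * (9 * n ^ 3 + 2 * (9 * n ^ 3) ^ 3) = 3 * (9 * a ^ 3 + 2 * (9 * a ^ 3) ^ 3)"
      unfolding shifted_cubic_coeffs by (simp only: coeff_pCons_Suc coeff_pCons_0 numeral_2_eq_2)
    then have "9 * n ^ 3 + 2 * (9 * n ^ 3) ^ 3 = 9 * a ^ 3 + 2 * (9 * a ^ 3) ^ 3"
      using three mult_cancel_left by blast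
    then show "n \<in> {n. poly q n = 0}"
      by (simp add: q_def poly_monom power_mult_distrib algebra_simps flip: power_mult)
  qed
  ultimately show False using finite_subset by blast
qed

lemma algebraic_int_coeff_shifted_cubic:
  fixes m :: "'a::field_char_0"
  assumes "m \<in> \<int>"
  shows "algebraic_int (coeff (shifted_cubic m) i)"
  using assms unfolding shifted_cubic_coeffs
  by (intro int_imp_algebraic_int)
     (auto simp: coeff_pCons split: nat.split)

theorem corollary5p2:
  shows "(infinite (UNIV :: 'a::field set) \<and> CHAR('a) \<noteq> 2 \<and> CHAR('a) \<noteq> 3 \<and>
            \<not> (\<exists>x::'a. x ^ 3 = 2)
          \<longrightarrow> N32_inf TYPE('a))
       \<and> (number_field TYPE('k::field_char_0) \<and> \<not> (\<exists>x::'k. x ^ 3 = 2)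
          \<longrightarrow> infinite {f :: 'k poly. lead_coeff f = 1 \<and> (\<forall>i. coeff f i \<in> ring_of_integers) \<and>
                degree f = 3 \<and> newly_reducible_second_iterate f})"
proof (intro conjI impI)
  assume K: "infinite (UNIV :: 'a set) \<and> CHAR('a) \<noteq> 2 \<and> CHAR('a) \<noteq> 3 \<and> \<not> (\<exists>x::'a. x ^ 3 = 2)"
  have three: "(3::'a) \<noteq> 0"
  proof
    assume "(3::'a) = 0"
    then have "of_nat 3 = (0::'a)" by simp
    then have "CHAR('a) dvd 3" by (simp only: of_nat_eq_0_iff_char_dvd)
    moreover have "prime (3::nat)" by simp
    ultimately have "CHAR('a) = 1 \<or> CHAR('a) = 3" by (auto simp: prime_nat_iff)
    then show False using K by (simp add: CHAR_not_1')
  qed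
  have "infinite (- {0} :: 'a set)" using K by (simp add: Compl_eq_Diff_UNIV)
  from infinite_shifted_cubics[OF this three] show "N32_inf TYPE('a)"
    unfolding N32_inf_def
    by (rule infinite_super[rotated])
       (use K three in \<open>auto simp: degree_shifted_cubic newly_reducible_shifted_cubic\<close>)
next
  assume K: "number_field TYPE('k) \<and> \<not> (\<exists>x::'k. x ^ 3 = 2)"
  have "infinite (of_nat ` {0<..} :: 'k set)"
    by (subst finite_image_iff) (auto simp: inj_on_def infinite_Ioi)
  from infinite_shifted_cubics[OF this]
  have "infinite ((\<lambda>n::'k. shifted_cubic (9 * n ^ 3)) ` of_nat ` {0<..})" by simp
  then show "infinite {f :: 'k poly. lead_coeff f = 1 \<and> (\<forall>i. coeff f i \<in> ring_of_integers) \<and>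
      degree f = 3 \<and> newly_reducible_second_iterate f}"
  proof (rule infinite_super[rotated], safe)
    fix j :: nat assume "j > 0"
    define n where "n = (of_nat j :: 'k)"
    have "n \<noteq> 0" "9 * n ^ 3 \<in> \<int>" using \<open>j > 0\<close> by (auto simp: n_def)
    show "degree (shifted_cubic (9 * of_nat j ^ 3 :: 'k)) = 3" by (rule degree_shifted_cubic)
    show "lead_coeff (shifted_cubic (9 * of_nat j ^ 3 :: 'k)) = 1"
      by (simp add: shifted_cubic_coeffs)
    show "coeff (shifted_cubic (9 * of_nat j ^ 3 :: 'k)) i \<in> ring_of_integers" for i
      unfolding ring_of_integers_def
      using algebraic_int_coeff_shifted_cubic[OF \<open>9 * n ^ 3 \<in> \<int>\<close>] by (simp add: n_def)
    show "newly_reducible_second_iterate (shifted_cubic (9 * of_nat j ^ 3 :: 'k))"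
      using newly_reducible_shifted_cubic[of n] K \<open>n \<noteq> 0\<close> by (simp add: n_def)
  qed
qed

end
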